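(* Let $n\ge 2$, let $b\in\{1,-1\}$, let $c\ge 0$ and $d$ be real numbers with $\lambda=c-d\neq 0$, and let $Q$ be the real symmetric $n\times n$ tridiagonal matrix with $Q_{11}=Q_{nn}=d$, $Q_{ii}=c$ for $2\le i\le n-1$, $Q_{i,i+1}=Q_{i+1,i}=-b$ for $1\le i\le n-1$, and all other entries $0$. Let $\beta_i = U_i(c/2)-\lambda U_{i-1}(c/2)$ for $i=0,1,\dots,n-1$. Then $Q^{-1}$ exists if and only if $d\beta_{n-1}-\beta_{n-2}\neq 0$. If $Q^{-1}$ exists, then it is symmetric and $Q^{-1}_{ij}=u_iv_j$ for all $1\le i\le j\le n$, where $$v_i=\frac{b^{i-1}\beta_{n-i}}{d\beta_{n-1}-\beta_{n-2}},\qquad u_i=b^{i-1}\beta_{i-1}\qquad (i=1,\dots,n).$$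
   Context: $U_m$ denotes the Chebyshev polynomial of the second kind: $U_{-1}(x)=0$, $U_0(x)=1$, $U_1(x)=2x$, and $U_{m+1}(x)-2xU_m(x)+U_{m-1}(x)=0$ for $m\ge 1$. Here $Q^{-1}_{ij}$ is the $(i,j)$ entry of $Q^{-1}$. *)

theory Defs
  imports "Jordan_Normal_Form.Matrix" "HOL-Computational_Algebra.Polynomial" Complex_Main
begin

fun chebyshev_U_nat :: "nat \<Rightarrow> real poly" where
  "chebyshev_U_nat 0 = 1"
| "chebyshev_U_nat (Suc 0) = [:0, 2:]"
| "chebyshev_U_nat (Suc (Suc m)) = [:0, 2:] * chebyshev_U_nat (Suc m) - chebyshev_U_nat m"

text \<open>The index is an integer so that \<open>U\<^sub>-\<^sub>1 = 0\<close> can be written; indices below \<open>-1\<close> are not used.\<close>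

definition chebyshev_U :: "int \<Rightarrow> real poly" where
  "chebyshev_U m = (if m < 0 then 0 else chebyshev_U_nat (nat m))"

lemma chebyshev_U_initial:
  "chebyshev_U (-1) = 0" "chebyshev_U 0 = 1" "chebyshev_U 1 = [:0, 2:]"
  by (simp_all add: chebyshev_U_def)

lemma chebyshev_U_rec:
  assumes "m \<ge> 1"
  shows "chebyshev_U (m + 1) - [:0, 2:] * chebyshev_U m + chebyshev_U (m - 1) = 0"
proof -
  obtain k where "m = int (Suc k)"
    using assms by (metis Suc_le_D nat_0_le nat_mono nat_one_as_int nat_le_iff zero_le_one order_trans of_nat_1 One_nat_def)
  then have "nat (m + 1) = Suc (Suc k)" "nat m = Suc k" "nat (m - 1) = k"
    by simp_all
  with assms show ?thesis
    by (simp add: chebyshev_U_def)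
qed

text \<open>Rows and columns of matrices are indexed from \<open>0\<close>, so the corner entries sit at
  \<open>(0, 0)\<close> and \<open>(n - 1, n - 1)\<close>. In contrast, the indices of \<open>u_seq\<close> and \<open>v_seq\<close> below
  run through \<open>1, \<dots>, n\<close>.\<close>

definition tridiag :: "nat \<Rightarrow> real \<Rightarrow> real \<Rightarrow> real \<Rightarrow> real mat" where
  "tridiag n b c d = mat n n (\<lambda>(i, j).
     if i = j then (if i = 0 \<or> i = n - 1 then d else c)
     else if j = i + 1 \<or> i = j + 1 then - b
     else 0)"

definition beta :: "real \<Rightarrow> real \<Rightarrow> nat \<Rightarrow> real" where
  "beta c d i = poly (chebyshev_U (int i)) (c / 2)
     - (c - d) * poly (chebyshev_U (int i - 1)) (c / 2)"

definition u_seq :: "real \<Rightarrow> real \<Rightarrow> real \<Rightarrow> nat \<Rightarrow> real" where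
  "u_seq b c d i = b ^ (i - 1) * beta c d (i - 1)"

definition v_seq :: "nat \<Rightarrow> real \<Rightarrow> real \<Rightarrow> real \<Rightarrow> nat \<Rightarrow> real" where
  "v_seq n b c d i =
     b ^ (i - 1) * beta c d (n - i) / (d * beta c d (n - 1) - beta c d (n - 2))"

end

theory Submission
  imports Defs
begin

text \<open>The vector \<open>x\<close> with entries \<open>u\<^sub>i\<close> solves all rows of \<open>Q x = 0\<close> except the last, where
  \<open>Q x\<close> equals \<open>\<plusminus> D\<close> with \<open>D = d \<beta>\<^sub>n\<^sub>-\<^sub>1 - \<beta>\<^sub>n\<^sub>-\<^sub>2\<close>; so \<open>D = 0\<close> makes \<open>Q\<close> singular. If \<open>D \<noteq> 0\<close>,
  the reversed vector \<open>v\<close> solves all rows except the first, and gluing \<open>u\<close> and \<open>v\<close> along the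
  diagonal gives a discrete Green's function for \<open>Q\<close>. The diagonal rows hold because the
  Casoratian of \<open>u\<close> and \<open>v\<close> is constant.\<close>

lemma beta_0 [simp]: "beta c d 0 = 1"
  by (simp add: beta_def chebyshev_U_def)

text \<open>Since U_1(c/2) = c, subtracting c - d leaves the corner entry d. This start value
  encodes the first row of the matrix.\<close>

lemma beta_Suc_0 [simp]: "beta c d (Suc 0) = d"
  by (simp add: beta_def chebyshev_U_def)

text \<open>Both Chebyshev terms obey the recurrence at x = c/2. The case \<open>i = 0\<close> is
  separate because it reaches U_{-1}, which comes from the default branch of
  \<open>chebyshev_U\<close>.\<close>

lemma beta_Suc_Suc: "beta c d (Suc (Suc i)) = c * beta c d (Suc i) - beta c d i"
proof (cases i)
  case 0
  then show ?thesis
    by (simp add: beta_def chebyshev_U_def algebra_simps numeral_2_eq_2)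
next
  case (Suc k)
  have "nat (int k + 1) = Suc k" "nat (int k + 2) = Suc (Suc k)" "nat (int k + 3) = Suc (Suc (Suc k))"
    by simp_all
  then show ?thesis
    using Suc by (simp add: beta_def chebyshev_U_def algebra_simps)
qed

text \<open>The recurrence lets one step move from i to m, so the left side depends only on i + m.
  At i = 0 it is the right side, by the values of beta at 0 and 1.\<close>

lemma beta_casoratian:
  "beta c d (Suc i) * beta c d (Suc m) - beta c d i * beta c d m
     = d * beta c d (Suc (i + m)) - beta c d (i + m)"
proof (induction i arbitrary: m)
  case 0
  show ?case by simp
next
  case (Suc i)
  show ?case
    using Suc.IH[of "Suc m"] by (simp add: beta_Suc_Suc algebra_simps)
qed

definition tridiag_row :: "nat \<Rightarrow> real \<Rightarrow> real \<Rightarrow> real \<Rightarrow> (nat \<Rightarrow> real) \<Rightarrow> nat \<Rightarrow> real" where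
  "tridiag_row n b c d f i =
     (if i = 0 \<or> i = n - 1 then d else c) * f i
       - (if i = 0 then 0 else b * f (i - 1)) - (if i + 1 < n then b * f (i + 1) else 0)"

lemma tridiag_carrier [simp]: "tridiag n b c d \<in> carrier_mat n n"
  by (simp add: tridiag_def)

lemma dim_tridiag [simp]: "dim_row (tridiag n b c d) = n" "dim_col (tridiag n b c d) = n"
  by (simp_all add: tridiag_def)

lemma transpose_tridiag: "transpose_mat (tridiag n b c d) = tridiag n b c d"
  by (rule eq_matI) (auto simp: tridiag_def)

lemma sum_tridiag_row:
  assumes "i < n"
  shows "(\<Sum>k = 0..<n. tridiag n b c d $$ (i, k) * f k) = tridiag_row n b c d f i"
proof -
  let ?e = "if i = 0 \<or> i = n - 1 then d else c"
  \<comment> \<open>The row splits into three one-point sums. The inner test \<open>i = 0\<close>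
    matters because \<open>i - 1\<close> then truncates to 0, the diagonal position.\<close>
  have "(\<Sum>k = 0..<n. tridiag n b c d $$ (i, k) * f k)
      = (\<Sum>k = 0..<n. (if k = i then ?e * f k else 0)
          - (if k = i - 1 then (if i = 0 then 0 else b * f k) else 0)
          - (if k = i + 1 then b * f k else 0))"
    using assms by (intro sum.cong) (auto simp: tridiag_def)
  also have "\<dots> = tridiag_row n b c d f i"
    using assms by (simp add: sum_subtractf tridiag_row_def)
  finally show ?thesis .
qed

text \<open>As b squared is 1, the powers of b cancel and the recurrence of beta remains. The last
  row has no right neighbour and diagonal entry d, which leaves the nonzero case.\<close>

lemma u_seq_row:
  assumes "n \<ge> 2" and "b \<in> {1, -1}" and "i < n"
  shows "tridiag_row n b c d (\<lambda>k. u_seq b c d (Suc k)) i =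
    (if i = n - 1 then b ^ i * (d * beta c d (n - 1) - beta c d (n - 2)) else 0)"
proof (cases i)
  case 0
  then show ?thesis
    using assms by (auto simp: tridiag_row_def u_seq_def)
next
  case (Suc k)
  have b: "b * (b * z) = z" for z using assms(2) by auto
  show ?thesis
  proof (cases "i = n - 1")
    case True
    with Suc have "n - 2 = k" by simp
    then show ?thesis
      using assms Suc True[symmetric] b
      by (simp add: tridiag_row_def u_seq_def algebra_simps)
  next
    case False
    then show ?thesis
      using assms Suc
      by (auto simp: tridiag_row_def u_seq_def beta_Suc_Suc b algebra_simps)
  qed
qed

lemma v_seq_row:
  assumes "n \<ge> 2" and "b \<in> {1, -1}" and "0 < i" and "i < n"
  shows "tridiag_row n b c d (\<lambda>k. v_seq n b c d (Suc k)) i = 0"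
proof -
  define D where "D = d * beta c d (n - 1) - beta c d (n - 2)"
  obtain k where i: "i = Suc k" using assms(3) by (cases i) auto
  have b: "b * (b * z) = z" for z using assms(2) by auto
  show ?thesis
  proof (cases "i = n - 1")
    case True
    with i have n: "n = Suc (Suc k)" by simp
    show ?thesis
      using b by (simp add: tridiag_row_def v_seq_def i n algebra_simps)
  next
    case False
    \<comment> \<open>Counted from the right end, the entries of v at i - 1, i, i + 1 carry beta at
      m + 2, m + 1, m.\<close>
    define m where "m = n - i - 2"
    have n: "n = Suc (Suc (Suc (k + m)))" using False i assms(4) by (simp add: m_def)
    have "n - Suc k = Suc (Suc m)" "n - Suc (Suc k) = Suc m" "n - Suc (Suc (Suc k)) = m"
      by (simp_all add: n)
    then show ?thesis
      using assms i False b
      by (simp add: tridiag_row_def v_seq_def D_def[symmetric] beta_Suc_Suc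
          diff_divide_distrib[symmetric] add_divide_distrib[symmetric] algebra_simps)
  qed
qed

text \<open>The powers of b multiply to 1, and \<open>beta_casoratian\<close> produces exactly the
  denominator of v. This gives the unit jump across the diagonal.\<close>

lemma u_v_casoratian:
  assumes "b \<in> {1, -1}" and "Suc i < n"
    and "d * beta c d (n - 1) - beta c d (n - 2) \<noteq> 0"
  shows "b * (u_seq b c d (Suc (Suc i)) * v_seq n b c d (Suc i)
            - u_seq b c d (Suc i) * v_seq n b c d (Suc (Suc i))) = 1"
proof -
  define D where "D = d * beta c d (n - 1) - beta c d (n - 2)"
  define m where "m = n - i - 2"
  have n: "n = Suc (Suc (i + m))" using assms(2) by (simp add: m_def)
  have D: "beta c d (Suc i) * beta c d (Suc m) - beta c d i * beta c d m = D"
    unfolding beta_casoratian D_def by (simp add: n)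
  have u: "u_seq b c d (Suc (Suc i)) = b * b ^ i * beta c d (Suc i)"
    "u_seq b c d (Suc i) = b ^ i * beta c d i"
    by (simp_all add: u_seq_def)
  have v: "v_seq n b c d (Suc i) = b ^ i * beta c d (Suc m) / D"
    "v_seq n b c d (Suc (Suc i)) = b * b ^ i * beta c d m / D"
    unfolding v_seq_def D_def[symmetric] by (simp_all add: n)
  have bb: "b * b = 1" "b ^ i * b ^ i = 1"
    using assms(1) by (auto simp flip: power_add mult_2)
  have "b * (u_seq b c d (Suc (Suc i)) * v_seq n b c d (Suc i)
            - u_seq b c d (Suc i) * v_seq n b c d (Suc (Suc i)))
      = (b * b) * (b ^ i * b ^ i)
          * (beta c d (Suc i) * beta c d (Suc m) - beta c d i * beta c d m) / D"
    unfolding u v by (simp add: diff_divide_distrib algebra_simps)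
  also have "\<dots> = 1"
    using assms(3) unfolding D bb by (simp add: D_def)
  finally show ?thesis .
qed

text \<open>The candidate inverse: \<open>min\<close> and \<open>max\<close> extend the
  upper-triangle formula symmetrically, and \<open>Suc\<close> passes from matrix indices to the
  1-based sequences.\<close>

definition green :: "nat \<Rightarrow> real \<Rightarrow> real \<Rightarrow> real \<Rightarrow> real mat" where
  "green n b c d =
     mat n n (\<lambda>(i, j). u_seq b c d (Suc (min i j)) * v_seq n b c d (Suc (max i j)))"

lemma green_carrier [simp]: "green n b c d \<in> carrier_mat n n"
  by (simp add: green_def)

lemma dim_green [simp]: "dim_row (green n b c d) = n" "dim_col (green n b c d) = n"
  by (simp_all add: green_def)

lemma transpose_green: "transpose_mat (green n b c d) = green n b c d"
  by (rule eq_matI) (auto simp: green_def min.commute max.commute)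

text \<open>Off the diagonal, the three entries met by a row all lie on one branch, a multiple of u
  or of v.\<close>

lemma green_row:
  assumes "n \<ge> 2" and "b \<in> {1, -1}" and "i < n" and "j < n"
    and D: "d * beta c d (n - 1) - beta c d (n - 2) \<noteq> 0"
  shows "tridiag_row n b c d
      (\<lambda>k. u_seq b c d (Suc (min k j)) * v_seq n b c d (Suc (max k j))) i = (if i = j then 1 else 0)"
    (is "tridiag_row n b c d ?g i = _")
proof -
  let ?u = "\<lambda>k. u_seq b c d (Suc k)" and ?v = "\<lambda>k. v_seq n b c d (Suc k)"
  consider "i < j" | "j < i" | "i = j" by linarith
  then show ?thesis
  proof cases
    case 1
    then have "tridiag_row n b c d ?g i = ?v j * tridiag_row n b c d ?u i"
      by (auto simp: tridiag_row_def min_def max_def algebra_simps)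
    then show ?thesis
      using 1 assms u_seq_row[of n b i c d] by simp
  next
    case 2
    \<comment> \<open>The left neighbour may lie on the diagonal, where the two branches
      agree.\<close>
    then have "i - 1 = j \<or> j < i - 1" by linarith
    with 2 have "tridiag_row n b c d ?g i = ?u j * tridiag_row n b c d ?v i"
      by (auto simp: tridiag_row_def min_def max_def algebra_simps)
    then show ?thesis
      using 2 assms v_seq_row[of n b i c d] by simp
  next
    case 3
    \<comment> \<open>Continuing the u branch past the diagonal changes only the right neighbour;
      the correction is the Casoratian.\<close>
    have *: "tridiag_row n b c d ?g i = ?v i * tridiag_row n b c d ?u i
        + (if Suc i < n then b * (?u (Suc i) * ?v i - ?u i * ?v (Suc i)) else 0)"
      using 3 by (simp add: tridiag_row_def min_def max_def algebra_simps)
    show ?thesis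
    proof (cases "Suc i < n")
      case True
      then have "i \<noteq> n - 1" by simp
      with True show ?thesis
        unfolding * using 3 assms u_seq_row[of n b i c d] u_v_casoratian[of b i n d c] by simp
    next
      case False
      then have i: "i = n - 1" using assms by simp
      \<comment> \<open>In the last row the factor D from u cancels the denominator of v, leaving
        this square.\<close>
      have "b ^ i * b ^ i = 1"
        using assms(2) by (auto simp flip: power_add mult_2)
      then have "?v i * tridiag_row n b c d ?u i = 1"
        using D assms(1) u_seq_row[OF assms(1-3), of c d] i by (simp add: v_seq_def)
      then show ?thesis
        unfolding * using 3 False by simp
    qed
  qed
qed

lemma tridiag_mult_green:
  assumes "n \<ge> 2" and "b \<in> {1, -1}"
    and "d * beta c d (n - 1) - beta c d (n - 2) \<noteq> 0"
  shows "tridiag n b c d * green n b c d = 1\<^sub>m n"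
proof (rule eq_matI)
  fix i j assume "i < dim_row (1\<^sub>m n :: real mat)" "j < dim_col (1\<^sub>m n :: real mat)"
  then have ij: "i < n" "j < n" by simp_all
  have "(tridiag n b c d * green n b c d) $$ (i, j)
      = (\<Sum>k = 0..<n. tridiag n b c d $$ (i, k) * green n b c d $$ (k, j))"
    using ij by (simp add: scalar_prod_def)
  also have "\<dots> = (\<Sum>k = 0..<n. tridiag n b c d $$ (i, k)
      * (u_seq b c d (Suc (min k j)) * v_seq n b c d (Suc (max k j))))"
    using ij by (intro sum.cong) (auto simp: green_def)
  also have "\<dots> = (if i = j then 1 else 0)"
    using ij(1) by (simp only: sum_tridiag_row green_row[OF assms(1,2) ij assms(3)])
  finally show "(tridiag n b c d * green n b c d) $$ (i, j) = 1\<^sub>m n $$ (i, j)"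
    using ij by simp
qed simp_all

lemma green_mult_tridiag:
  assumes "n \<ge> 2" and "b \<in> {1, -1}"
    and "d * beta c d (n - 1) - beta c d (n - 2) \<noteq> 0"
  shows "green n b c d * tridiag n b c d = 1\<^sub>m n"
  using arg_cong[OF tridiag_mult_green[OF assms], of transpose_mat]
  by (simp add: transpose_mult[OF tridiag_carrier green_carrier] transpose_green transpose_tridiag)

text \<open>Otherwise the vector of the \<open>u_seq\<close> entries lies in the kernel, although
  its first entry is 1.\<close>

lemma tridiag_left_inverse_imp_nonzero:
  assumes "n \<ge> 2" and "b \<in> {1, -1}"
    and R: "R \<in> carrier_mat n n" and RQ: "R * tridiag n b c d = 1\<^sub>m n"
  shows "d * beta c d (n - 1) - beta c d (n - 2) \<noteq> 0"
proof
  assume D: "d * beta c d (n - 1) - beta c d (n - 2) = 0"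
  define x where "x = vec n (\<lambda>k. u_seq b c d (Suc k))"
  have x: "x \<in> carrier_vec n" by (simp add: x_def)
  have Qx: "tridiag n b c d *\<^sub>v x = 0\<^sub>v n"
  proof (rule eq_vecI)
    fix i assume "i < dim_vec (0\<^sub>v n :: real vec)"
    then have i: "i < n" by simp
    have "(tridiag n b c d *\<^sub>v x) $ i
        = (\<Sum>k = 0..<n. tridiag n b c d $$ (i, k) * u_seq b c d (Suc k))"
      using i by (simp add: scalar_prod_def x_def)
    also have "\<dots> = 0"
      using i D assms(1,2) by (simp add: sum_tridiag_row u_seq_row)
    finally show "(tridiag n b c d *\<^sub>v x) $ i = 0\<^sub>v n $ i" using i by simp
  qed simp_all
  have "x = (R * tridiag n b c d) *\<^sub>v x" using RQ x by simp
  also have "\<dots> = R *\<^sub>v (tridiag n b c d *\<^sub>v x)"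
    using R x by (intro assoc_mult_mat_vec) auto
  also have "\<dots> = 0\<^sub>v n" using R unfolding Qx by auto
  finally have "x $ 0 = 0" using assms(1) by simp
  then show False using assms(1) by (simp add: x_def u_seq_def)
qed

theorem theorem1:
  fixes n :: nat and b c d :: real
  assumes "n \<ge> 2" and "b \<in> {1, -1}" and "c \<ge> 0" and "c - d \<noteq> 0"
  shows "(invertible_mat (tridiag n b c d)
            \<longleftrightarrow> d * beta c d (n - 1) - beta c d (n - 2) \<noteq> 0)
       \<and> (\<forall>R \<in> carrier_mat n n.
            inverts_mat (tridiag n b c d) R \<and> inverts_mat R (tridiag n b c d) \<longrightarrow>
              transpose_mat R = R \<and>
              (\<forall>i j. 1 \<le> i \<and> i \<le> j \<and> j \<le> n \<longrightarrow>
                 R $$ (i - 1, j - 1) = u_seq b c d i * v_seq n b c d j))"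
proof -
  let ?Q = "tridiag n b c d" and ?G = "green n b c d"
  let ?D = "d * beta c d (n - 1) - beta c d (n - 2)"
  have "?D \<noteq> 0" if inv: "invertible_mat ?Q"
  proof -
    obtain R where QR: "?Q * R = 1\<^sub>m n" and RQ: "R * ?Q = 1\<^sub>m (dim_row R)"
      using inv by (auto simp: invertible_mat_def inverts_mat_def)
    \<comment> \<open>\<open>invertible_mat\<close> does not fix the shape of \<open>R\<close>;
      comparing column counts in the two products recovers it.\<close>
    have "dim_col R = n" using arg_cong[OF QR, of dim_col] by simp
    moreover have "dim_row R = n" using arg_cong[OF RQ, of dim_col] by simp
    ultimately have "R \<in> carrier_mat n n" by auto
    with RQ show ?thesis
      using tridiag_left_inverse_imp_nonzero[OF assms(1,2)] by auto
  qed
  moreover have "invertible_mat ?Q" if "?D \<noteq> 0"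
    using tridiag_mult_green[OF assms(1,2) that] green_mult_tridiag[OF assms(1,2) that]
    by (auto simp: invertible_mat_def inverts_mat_def)
  \<comment> \<open>Uniqueness of inverses transfers the symmetry and the entries of
    \<open>?G\<close> to any inverse \<open>R\<close>.\<close>
  moreover have "R = ?G"
    if R: "R \<in> carrier_mat n n" and RQ: "inverts_mat R ?Q" for R
  proof -
    have RQ: "R * ?Q = 1\<^sub>m n" using R RQ by (simp add: inverts_mat_def)
    have D: "?D \<noteq> 0"
      using tridiag_left_inverse_imp_nonzero[OF assms(1,2) R RQ] .
    have "R = R * (?Q * ?G)"
      using R by (simp add: tridiag_mult_green[OF assms(1,2) D])
    also have "\<dots> = R * ?Q * ?G"
      using R by (intro assoc_mult_mat[symmetric]) auto
    also have "\<dots> = ?G" by (simp add: RQ)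
    finally show ?thesis .
  qed
  moreover have "?G $$ (i - 1, j - 1) = u_seq b c d i * v_seq n b c d j"
    if "1 \<le> i" "i \<le> j" "j \<le> n" for i j
    using that by (auto simp: green_def min_def max_def)
  ultimately show ?thesis
    using transpose_green by blast
qed

end
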